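(* Let $A$ be an exponential nwqo, $n\in\mathbb{N}$, and $x\in A$ with $|x|_A<n$. Then there exists $\alpha'\in\partial_n\, o(A)$ such that $A/x\hookrightarrow C(\alpha')$.
   Context: A normed wqo (nwqo) is a wqo $(A,\leq_A)$ with a proper norm $|\cdot|_A:A\to\mathbb{N}$ (finitely many elements of norm $<n$ for each $n$). Basic nwqos: $\Gamma_p=\{a_1,\ldots,a_p\}$, letters pairwise incomparable, norm $0$. Constructions: disjoint sum $A+B$ (elements $\langle i,x\rangle$, comparable only within the same summand, norm of $x$); product $A\times B$ (componentwise order, norm = max of component norms); Kleene star $A^*$ (finite lists, $(x_1\ldots x_n)\leq(y_1\ldots y_m)$ iff $x_j\leq y_{i_j}$ for some $1\leq i_1<\cdots<i_n\leq m$, norm $\max(n,|x_1|,\ldots,|x_n|)$). An exponential nwqo is built from the $\Gamma_p$ by $+$, $\times$, and star applied only to the $\Gamma_p$'s. The residual $A/x$ is the substructure of $A$ (induced order and norm) on $\{y\in A: x\not\leq_A y\}$. A reflection $h:A\hookrightarrow B$ is a map with $h(x)\leq_B h(y)\Rightarrow x\leq_A y$ and $|h(x)|_B\leq|x|_A$; $A\hookrightarrow B$ means one exists. Ordinals are in Cantor normal form (CNF) below $\omega^{\omega^\omega}$; $\oplus,\otimes$ are natural sum and product. $o$: $o(\Gamma_p)=p$, $o(\Gamma_0^* )=1$, $o(\Gamma_{p+1}^* )=\omega^{\omega^p}$, $o(A+B)=o(A)\oplus o(B)$, $o(A\times B)=o(A)\otimes o(B)$. Conversely, for $\alpha=\omega^{\beta_1}+\cdots+\omega^{\beta_m}$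 with $\beta_i=\omega^{p_{i,1}}+\cdots+\omega^{p_{i,k_i}}$ ($p_{i,j}<\omega$), $C(\alpha)=\sum_{i=1}^m\prod_{j=1}^{k_i}\Gamma_{p_{i,j}+1}^*$ (empty sum $=\Gamma_0$, empty product $=\Gamma_1$). Derivatives, for $n>0$: $D_n(\omega^{\omega^p})=n-1$ if $p=0$ and $=\omega^{\omega^{p-1}\cdot(n-1)}\cdot(n-1)$ if $p>0$; $D_n(\omega^{\omega^{p_1}+\cdots+\omega^{p_k}})=\bigoplus_{j=1}^k\bigl(D_n(\omega^{\omega^{p_j}})\otimes\bigotimes_{\ell\neq j}\omega^{\omega^{p_\ell}}\bigr)$ (so $D_n(1)=0$); and $\partial_n(\sum_{i=1}^m\omega^{\beta_i})=\{D_n(\omega^{\beta_i})\oplus\bigoplus_{\ell\neq i}\omega^{\beta_\ell}: i=1,\ldots,m\}$. *)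

theory Defs
  imports "HOL-Library.Multiset_Order" "HOL-Library.Sublist" "HOL-Library.FuncSet"
begin

section \<open>Normed quasi-orders\<close>

record 'a nqo =
  carrier :: "'a set"
  le :: "'a \<Rightarrow> 'a \<Rightarrow> bool"
  nrm :: "'a \<Rightarrow> nat"

definition residual :: "'a nqo \<Rightarrow> 'a \<Rightarrow> 'a nqo" where
  "residual A x = A\<lparr>carrier := {y \<in> carrier A. \<not> le A x y}\<rparr>"

definition is_reflection :: "('a \<Rightarrow> 'b) \<Rightarrow> 'a nqo \<Rightarrow> 'b nqo \<Rightarrow> bool" where
  "is_reflection h A B \<longleftrightarrow>
     h \<in> carrier A \<rightarrow> carrier B \<and>
     (\<forall>x\<in>carrier A. \<forall>y\<in>carrier A. le B (h x) (h y) \<longrightarrow> le A x y) \<and>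
     (\<forall>x\<in>carrier A. nrm B (h x) \<le> nrm A x)"

definition reflects :: "'a nqo \<Rightarrow> 'b nqo \<Rightarrow> bool"  (infix "\<hookrightarrow>" 50) where
  "A \<hookrightarrow> B \<longleftrightarrow> (\<exists>h. is_reflection h A B)"


section \<open>Exponential nwqos\<close>

text \<open>
  Nested sums and products have elements of ever new shapes, so all exponential nwqos are
  interpreted over one type of elements, of which each uses a subset as its carrier. \<open>In i x\<close> is the
  element \<open>\<langle>i, x\<rangle>\<close> of a disjoint sum, with \<open>i\<close> either \<open>1\<close> or \<open>2\<close>.
\<close>

datatype elem = Letter nat | In nat elem | Tup elem elem | Word "elem list"

definition gamma_nqo :: "nat \<Rightarrow> elem nqo" where
  "gamma_nqo p = \<lparr>carrier = Letter ` {1..p}, le = (=), nrm = (\<lambda>_. 0)\<rparr>"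

definition sum_nqo :: "elem nqo \<Rightarrow> elem nqo \<Rightarrow> elem nqo" where
  "sum_nqo A B =
     \<lparr>carrier = In 1 ` carrier A \<union> In 2 ` carrier B,
      le = (\<lambda>u v. (\<exists>x y. u = In 1 x \<and> v = In 1 y \<and> le A x y) \<or>
                  (\<exists>x y. u = In 2 x \<and> v = In 2 y \<and> le B x y)),
      nrm = (\<lambda>u. case u of In i x \<Rightarrow> if i = 1 then nrm A x else nrm B x | _ \<Rightarrow> 0)\<rparr>"

definition prod_nqo :: "elem nqo \<Rightarrow> elem nqo \<Rightarrow> elem nqo" where
  "prod_nqo A B =
     \<lparr>carrier = {Tup x y | x y. x \<in> carrier A \<and> y \<in> carrier B},
      le = (\<lambda>u v. \<exists>x y x' y'. u = Tup x y \<and> v = Tup x' y' \<and> le A x x' \<and> le B y y'),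
      nrm = (\<lambda>u. case u of Tup x y \<Rightarrow> max (nrm A x) (nrm B y) | _ \<Rightarrow> 0)\<rparr>"

definition star_nqo :: "elem nqo \<Rightarrow> elem nqo" where
  "star_nqo A =
     \<lparr>carrier = Word ` lists (carrier A),
      le = (\<lambda>u v. \<exists>xs ys. u = Word xs \<and> v = Word ys \<and> list_emb (le A) xs ys),
      nrm = (\<lambda>u. case u of Word xs \<Rightarrow> Max (insert (length xs) (nrm A ` set xs)) | _ \<Rightarrow> 0)\<rparr>"

text \<open>
  An exponential nwqo is given by the expression that builds it, since the order type below is
  defined by recursion on the construction. There is no star of anything but a \<open>\<Gamma>\<^sub>p\<close>.
  That the interpretations are wqos with proper norms is a consequence of the constructions
  (Dickson's and Higman's lemmas), not a side condition.
\<close>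

datatype enwqo =
    Gamma nat
  | Gamma_star nat
  | Plus enwqo enwqo
  | Times enwqo enwqo

primrec nqo_of :: "enwqo \<Rightarrow> elem nqo" where
  "nqo_of (Gamma p) = gamma_nqo p"
| "nqo_of (Gamma_star p) = star_nqo (gamma_nqo p)"
| "nqo_of (Plus A B) = sum_nqo (nqo_of A) (nqo_of B)"
| "nqo_of (Times A B) = prod_nqo (nqo_of A) (nqo_of B)"

fun big_plus :: "enwqo list \<Rightarrow> enwqo" where
  "big_plus [] = Gamma 0"
| "big_plus [A] = A"
| "big_plus (A # B # As) = Plus A (big_plus (B # As))"

fun big_times :: "enwqo list \<Rightarrow> enwqo" where
  "big_times [] = Gamma 1"
| "big_times [A] = A"
| "big_times (A # B # As) = Times A (big_times (B # As))"


section \<open>Ordinals below \<open>\<omega>\<^bsup>\<omega>\<^bsup>\<omega>\<^esup>\<^esup>\<close> in Cantor normal form\<close>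

text \<open>
  A Cantor normal form \<open>\<omega>\<^bsup>\<beta>\<^sub>1\<^esup> + \<dots> + \<omega>\<^bsup>\<beta>\<^sub>m\<^esup>\<close> with \<open>\<beta>\<^sub>1 \<ge> \<dots> \<ge> \<beta>\<^sub>m\<close> is determined by the multiset of
  its exponents, and each exponent \<open>\<omega>\<^bsup>p\<^sub>1\<^esup> + \<dots> + \<omega>\<^bsup>p\<^sub>k\<^esup>\<close> by the multiset of the numbers \<open>p\<^sub>j\<close>. The
  order of ordinals is then the multiset order, which is the order that the library puts on
  \<^typ>\<open>nat multiset\<close>. \<open>+\<close> and \<open>*\<close> on this type are the natural sum and product.
\<close>

datatype ordinal = CNF (exponents: "nat multiset multiset")

instantiation ordinal :: comm_semiring_1
begin

definition zero_ordinal :: ordinal where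
  "0 = CNF {#}"

definition one_ordinal :: ordinal where
  "1 = CNF {#{#}#}"

definition plus_ordinal :: "ordinal \<Rightarrow> ordinal \<Rightarrow> ordinal" where
  "\<alpha> + \<beta> = CNF (exponents \<alpha> + exponents \<beta>)"

definition times_ordinal :: "ordinal \<Rightarrow> ordinal \<Rightarrow> ordinal" where
  "\<alpha> * \<beta> = CNF (\<Sum>a\<in>#exponents \<alpha>. {#a + b. b \<in># exponents \<beta>#})"

instance
proof
  fix a b c :: ordinal
  have swap: "(\<Sum>x\<in>#M. {#x + y. y \<in># N#}) = (\<Sum>y\<in>#N. {#y + x. x \<in># M#})"
    for M N :: "nat multiset multiset"
  proof (induction M)
    case empty
    then show ?case by (induction N) auto
  next
    case (add x M)
    have "(\<Sum>y\<in>#N. {#y + z. z \<in># add_mset x M#}) = {#x + y. y \<in># N#} + (\<Sum>y\<in>#N. {#y + z. z \<in># M#})"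
      by (induction N) (auto simp: ac_simps)
    with add show ?case by simp
  qed
  have dist: "(\<Sum>x\<in>#M + M'. F x) = (\<Sum>x\<in>#M. F x) + (\<Sum>x\<in>#M'. F x)"
    for M M' :: "nat multiset multiset" and F :: "nat multiset \<Rightarrow> nat multiset multiset"
    by simp
  have img: "{#z + y. y \<in># (\<Sum>u\<in>#M. F u)#} = (\<Sum>u\<in>#M. {#z + y. y \<in># F u#})"
    for z and M :: "nat multiset multiset" and F :: "nat multiset \<Rightarrow> nat multiset multiset"
    by (induction M) auto
  have shift: "(\<Sum>x\<in>#{#z + y. y \<in># N#}. {#x + w. w \<in># K#}) =
      {#z + y. y \<in># (\<Sum>x\<in>#N. {#x + w. w \<in># K#})#}"
    for z and N K :: "nat multiset multiset"
    by (induction N) (auto simp: multiset.map_comp add.assoc intro!: image_mset_cong)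
  show "a * b * c = a * (b * c)"
  proof -
    have "(\<Sum>x\<in>#(\<Sum>x\<in>#M. {#x + y. y \<in># N#}). {#x + w. w \<in># K#}) =
        (\<Sum>x\<in>#M. {#x + y. y \<in># (\<Sum>x\<in>#N. {#x + w. w \<in># K#})#})"
      for M N K :: "nat multiset multiset"
      by (induction M) (auto simp: shift)
    then show ?thesis by (simp add: times_ordinal_def)
  qed
  show "a * b = b * a"
    by (simp add: times_ordinal_def swap)
  show "(a + b) * c = a * c + b * c"
    by (simp add: times_ordinal_def plus_ordinal_def)
  have "image_mset ((+) {#}) M = M" for M :: "nat multiset multiset"
    by (induction M) auto
  then show "1 * a = a"
    by (simp add: times_ordinal_def one_ordinal_def)
  show "0 * a = 0"
    by (simp add: times_ordinal_def zero_ordinal_def)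
  then show "a * 0 = 0"
    by (simp add: times_ordinal_def zero_ordinal_def swap [of _ "{#}"])
  show "(0::ordinal) \<noteq> 1"
    by (simp add: zero_ordinal_def one_ordinal_def)
qed (simp_all add: plus_ordinal_def zero_ordinal_def ac_simps)

end

text \<open>The ordinal \<open>\<omega>\<^bsup>\<beta>\<^esup>\<close>; in particular \<open>\<omega>\<^bsup>\<omega>\<^bsup>p\<^esup>\<^esup>\<close> is \<open>omega_pow {#p#}\<close> and \<open>\<omega>\<^bsup>\<omega>\<^bsup>p\<^esup>\<cdot>k\<^esup>\<close> is
  \<open>omega_pow (replicate_mset k p)\<close>.\<close>

definition omega_pow :: "nat multiset \<Rightarrow> ordinal" where
  "omega_pow \<beta> = CNF {#\<beta>#}"

fun otype :: "enwqo \<Rightarrow> ordinal" where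
  "otype (Gamma p) = of_nat p"
| "otype (Gamma_star 0) = 1"
| "otype (Gamma_star (Suc p)) = omega_pow {#p#}"
| "otype (Plus A B) = otype A + otype B"
| "otype (Times A B) = otype A * otype B"

text \<open>The summands of \<open>C(\<alpha>)\<close> and the factors of each summand come in the decreasing order of the
  Cantor normal form.\<close>

definition canon_term :: "nat multiset \<Rightarrow> enwqo" where
  "canon_term \<beta> = big_times (map (\<lambda>p. Gamma_star (p + 1)) (rev (sorted_list_of_multiset \<beta>)))"

definition canon :: "ordinal \<Rightarrow> enwqo" where
  "canon \<alpha> = big_plus (map canon_term (rev (sorted_list_of_multiset (exponents \<alpha>))))"


section \<open>Derivatives\<close>

text \<open>\<open>D\<^sub>n(\<omega>\<^bsup>\<omega>\<^bsup>p\<^esup>\<^esup>)\<close>. The factor \<open>n - 1\<close> may be taken with the natural product, which agrees with the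
  ordinal product for a finite right factor and a power of \<open>\<omega>\<close> on the left.\<close>

definition deriv_atom :: "nat \<Rightarrow> nat \<Rightarrow> ordinal" where
  "deriv_atom n p =
     (if p = 0 then of_nat (n - 1)
      else omega_pow (replicate_mset (n - 1) (p - 1)) * of_nat (n - 1))"

text \<open>\<open>D\<^sub>n(\<omega>\<^bsup>\<beta>\<^esup>)\<close>. Sums and products over multisets count each index with its multiplicity, and
  \<^term>\<open>\<beta> - {#p#}\<close> leaves out a single occurrence of \<open>p\<close>.\<close>

definition deriv_term :: "nat \<Rightarrow> nat multiset \<Rightarrow> ordinal" where
  "deriv_term n \<beta> = (\<Sum>p\<in>#\<beta>. deriv_atom n p * (\<Prod>q\<in>#\<beta> - {#p#}. omega_pow {#q#}))"

definition derivs :: "nat \<Rightarrow> ordinal \<Rightarrow> ordinal set" where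
  "derivs n \<alpha> = {deriv_term n \<beta> + (\<Sum>\<gamma>\<in>#exponents \<alpha> - {#\<beta>#}. omega_pow \<gamma>) | \<beta>. \<beta> \<in># exponents \<alpha>}"

end

theory Submission
  imports Defs
begin

text \<open>
  Expressions up to mutual reflection form an ordered commutative semiring under \<open>+\<close> and \<open>\<times>\<close>, and
  \<open>\<alpha> \<mapsto> [C(\<alpha>)]\<close> is a homomorphism into it from the ordinals with natural sum and product; hence
  \<open>[A] = [C(o(A))]\<close>. A reflection \<open>h : A \<hookrightarrow> B\<close> is also a reflection \<open>A/x \<hookrightarrow> B/h(x)\<close> and does not increase
  \<open>|x|\<close>, so bounds on residuals depend on the class of \<open>A\<close> only, and \<open>A\<close> may be replaced by
  the sum of products of stars \<open>C(o(A))\<close>. There \<open>(A + B)/x\<close> is \<open>A/x + B\<close> or \<open>A + B/x\<close>, \<open>(A \<times> B)/(x, y)\<close>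
  reflects into \<open>A/x \<times> B + A \<times> B/y\<close>, which are the recursions of \<open>\<partial>\<^sub>n\<close> and \<open>D\<^sub>n\<close>, and cutting
  a word at its first letter \<open>a\<close> yields
  \<open>\<Gamma>\<^sub>p\<^sub>+\<^sub>1\<^sup>*/aw \<hookrightarrow> \<Gamma>\<^sub>p\<^sup>* + \<Gamma>\<^sub>p\<^sup>* \<times> \<Gamma>\<^sub>p\<^sub>+\<^sub>1\<^sup>*/w\<close>. With \<open>g = [\<Gamma>\<^sub>p\<^sup>*] \<ge> 1\<close> and \<open>m < n\<close> letters this gives the bound
  \<open>g + g\<^sup>2 + \<dots> + g\<^sup>m \<le> (n - 1) g\<^sup>n\<^sup>-\<^sup>1\<close>, the class of \<open>D\<^sub>n(\<omega>\<^bsup>\<omega>\<^bsup>p\<^esup>\<^esup>)\<close>.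
\<close>

section \<open>Reflections between sums, products and stars\<close>

lemma reflectsI:
  assumes "\<And>x. x \<in> carrier A \<Longrightarrow> h x \<in> carrier B"
    and "\<And>x y. x \<in> carrier A \<Longrightarrow> y \<in> carrier A \<Longrightarrow> le B (h x) (h y) \<Longrightarrow> le A x y"
    and "\<And>x. x \<in> carrier A \<Longrightarrow> nrm B (h x) \<le> nrm A x"
  shows "A \<hookrightarrow> B"
  using assms unfolding reflects_def is_reflection_def by blast

lemma reflects_refl: "A \<hookrightarrow> A"
  by (rule reflectsI[of _ "\<lambda>x. x"]) auto

lemma reflects_trans:
  assumes "A \<hookrightarrow> B" "B \<hookrightarrow> C"
  shows "A \<hookrightarrow> C"
proof -
  obtain f g where fg: "is_reflection f A B" "is_reflection g B C"
    using assms by (auto simp: reflects_def)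
  show ?thesis
  proof (rule reflectsI[of _ "\<lambda>x. g (f x)"])
    fix x y
    assume x: "x \<in> carrier A"
    with fg show "g (f x) \<in> carrier C"
      by (auto simp: is_reflection_def)
    from fg x have "nrm C (g (f x)) \<le> nrm B (f x)" "nrm B (f x) \<le> nrm A x"
      by (auto simp: is_reflection_def)
    then show "nrm C (g (f x)) \<le> nrm A x"
      by linarith
    assume "y \<in> carrier A" "le C (g (f x)) (g (f y))"
    with fg x show "le A x y"
      unfolding is_reflection_def Pi_iff by metis
  qed
qed

lemma reflects_empty: "carrier A = {} \<Longrightarrow> A \<hookrightarrow> B"
  by (rule reflectsI) auto

text \<open>The reflection \<open>h\<close> itself maps between the residuals: \<open>h x\<close>
  below \<open>h z\<close> would force \<open>x\<close> below \<open>z\<close>, so elements avoiding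
  \<open>x\<close> go to elements avoiding \<open>h x\<close>.\<close>

lemma reflects_residual:
  assumes "A \<hookrightarrow> B" "x \<in> carrier A"
  obtains y where "y \<in> carrier B" "nrm B y \<le> nrm A x" "residual A x \<hookrightarrow> residual B y"
proof -
  from assms(1) obtain h where h: "is_reflection h A B"
    by (auto simp: reflects_def)
  with assms(2) have "residual A x \<hookrightarrow> residual B (h x)"
    by (intro reflectsI[of _ h]) (auto simp: residual_def is_reflection_def)
  with h assms(2) show thesis
    by (intro that[of "h x"]) (auto simp: is_reflection_def)
qed

lemma carrier_sum [simp]: "carrier (sum_nqo A B) = In 1 ` carrier A \<union> In 2 ` carrier B"
  by (simp add: sum_nqo_def)

lemma nrm_sum [simp]: "nrm (sum_nqo A B) (In i x) = (if i = 1 then nrm A x else nrm B x)"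
  by (simp add: sum_nqo_def)

lemma le_sum [simp]: "le (sum_nqo A B) (In i x) (In j y) \<longleftrightarrow>
    i = j \<and> (i = 1 \<and> le A x y \<or> i = 2 \<and> le B x y)"
  by (auto simp: sum_nqo_def)

lemma carrier_prod [simp]:
  "carrier (prod_nqo A B) = {Tup x y | x y. x \<in> carrier A \<and> y \<in> carrier B}"
  by (auto simp: prod_nqo_def)

lemma nrm_prod [simp]: "nrm (prod_nqo A B) (Tup x y) = max (nrm A x) (nrm B y)"
  by (simp add: prod_nqo_def)

lemma le_prod [simp]: "le (prod_nqo A B) (Tup x y) (Tup x' y') \<longleftrightarrow> le A x x' \<and> le B y y'"
  by (auto simp: prod_nqo_def)

lemma gamma_simps [simp]:
  "carrier (gamma_nqo p) = Letter ` {1..p}"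
  "nrm (gamma_nqo p) x = 0"
  "le (gamma_nqo p) = (=)"
  by (simp_all add: gamma_nqo_def)

lemma carrier_star [simp]: "carrier (star_nqo A) = Word ` lists (carrier A)"
  by (simp add: star_nqo_def)

lemma le_star [simp]: "le (star_nqo A) (Word xs) (Word ys) \<longleftrightarrow> list_emb (le A) xs ys"
  by (simp add: star_nqo_def)

lemma nrm_star_gamma [simp]: "nrm (star_nqo (gamma_nqo p)) (Word xs) = length xs"
  by (cases xs) (auto simp: star_nqo_def image_constant_conv)

lemma residual_simps [simp]:
  "carrier (residual A x) = {y \<in> carrier A. \<not> le A x y}"
  "le (residual A x) = le A"
  "nrm (residual A x) = nrm A"
  by (simp_all add: residual_def)

section \<open>Semiring laws for sum and product, up to reflection\<close>

lemma sum_mono: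
  assumes "A \<hookrightarrow> A'" "B \<hookrightarrow> B'"
  shows "sum_nqo A B \<hookrightarrow> sum_nqo A' B'"
proof -
  obtain f g where "is_reflection f A A'" "is_reflection g B B'"
    using assms by (auto simp: reflects_def)
  then show ?thesis
    by (intro reflectsI[of _ "\<lambda>u. case u of In i x \<Rightarrow> In i (if i = 1 then f x else g x)"])
       (auto simp: is_reflection_def)
qed

lemma sum_commute: "sum_nqo A B \<hookrightarrow> sum_nqo B A"
  by (rule reflectsI[of _ "\<lambda>u. case u of In i x \<Rightarrow> In (3 - i) x"]) auto

lemma sum_assoc: "sum_nqo (sum_nqo A B) C \<hookrightarrow> sum_nqo A (sum_nqo B C)"
  by (rule reflectsI[of _ "\<lambda>u. case u of In i x \<Rightarrow> if i = 1
        then (case x of In j y \<Rightarrow> if j = 1 then In 1 y else In 2 (In 1 y)) else In 2 (In 2 x)"])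
     auto

lemma reflects_sum: "B \<hookrightarrow> sum_nqo A B"
  by (rule reflectsI[of _ "In 2"]) auto

lemma sum_empty: "sum_nqo (gamma_nqo 0) A \<hookrightarrow> A"
  by (rule reflectsI[of _ "\<lambda>u. case u of In i x \<Rightarrow> x"]) auto

lemma prod_mono:
  assumes "A \<hookrightarrow> A'" "B \<hookrightarrow> B'"
  shows "prod_nqo A B \<hookrightarrow> prod_nqo A' B'"
proof -
  obtain f g where "is_reflection f A A'" "is_reflection g B B'"
    using assms by (auto simp: reflects_def)
  then show ?thesis
    by (intro reflectsI[of _ "\<lambda>u. case u of Tup x y \<Rightarrow> Tup (f x) (g y)"])
       (auto simp: is_reflection_def intro!: max.mono simp del: max.bounded_iff)
qed

lemma prod_commute: "prod_nqo A B \<hookrightarrow> prod_nqo B A"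
  by (rule reflectsI[of _ "\<lambda>u. case u of Tup x y \<Rightarrow> Tup y x"]) auto

lemma prod_assoc: "prod_nqo (prod_nqo A B) C \<hookrightarrow> prod_nqo A (prod_nqo B C)"
  by (rule reflectsI[of _ "\<lambda>u. case u of Tup v z \<Rightarrow> case v of Tup x y \<Rightarrow> Tup x (Tup y z)"]) auto

lemma prod_unit: "prod_nqo (gamma_nqo 1) A \<hookrightarrow> A"
  by (rule reflectsI[of _ "\<lambda>u. case u of Tup x y \<Rightarrow> y"]) auto

lemma prod_unit_conv: "A \<hookrightarrow> prod_nqo (gamma_nqo 1) A"
  by (rule reflectsI[of _ "Tup (Letter 1)"]) auto

lemma prod_sum_distrib: "prod_nqo (sum_nqo A B) C \<hookrightarrow> sum_nqo (prod_nqo A C) (prod_nqo B C)"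
  by (rule reflectsI[of _ "\<lambda>u. case u of Tup v z \<Rightarrow> case v of In i x \<Rightarrow> In i (Tup x z)"]) auto

lemma prod_sum_distrib_conv:
  "sum_nqo (prod_nqo A C) (prod_nqo B C) \<hookrightarrow> prod_nqo (sum_nqo A B) C"
  by (rule reflectsI[of _ "\<lambda>u. case u of In i v \<Rightarrow> case v of Tup x z \<Rightarrow> Tup (In i x) z"]) auto

lemma gamma_Suc: "gamma_nqo (Suc p) \<hookrightarrow> sum_nqo (gamma_nqo 1) (gamma_nqo p)"
  by (rule reflectsI[of _ "\<lambda>u. if u = Letter (Suc p) then In 1 (Letter 1) else In 2 u"])
     (auto split: if_splits)

lemma gamma_Suc_conv: "sum_nqo (gamma_nqo 1) (gamma_nqo p) \<hookrightarrow> gamma_nqo (Suc p)"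
  by (rule reflectsI[of _ "\<lambda>u. case u of In i x \<Rightarrow> if i = 1 then Letter (Suc p) else x"]) auto

lemma star_gamma_0: "star_nqo (gamma_nqo 0) \<hookrightarrow> gamma_nqo 1"
  by (rule reflectsI[of _ "\<lambda>_. Letter 1"]) auto

lemma gamma_1_star: "gamma_nqo 1 \<hookrightarrow> star_nqo (gamma_nqo p)"
  by (rule reflectsI[of _ "\<lambda>_. Word []"]) auto

section \<open>Residuals of sums, products and stars\<close>

lemma residual_sum_left:
  "residual (sum_nqo A B) (In 1 x) \<hookrightarrow> sum_nqo (residual A x) B"
  by (rule reflectsI[of _ id]) auto

lemma residual_sum_right:
  "residual (sum_nqo A B) (In 2 x) \<hookrightarrow> sum_nqo A (residual B x)"
  by (rule reflectsI[of _ id]) auto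

text \<open>A pair avoiding \<open>Tup x y\<close> fails in at least one component; testing the
  first one decides the summand. Summands are incomparable, so the order has to be reflected only
  within each.\<close>

lemma residual_prod:
  "residual (prod_nqo A B) (Tup x y) \<hookrightarrow>
    sum_nqo (prod_nqo (residual A x) B) (prod_nqo A (residual B y))"
  by (rule reflectsI[of _ "\<lambda>u. case u of Tup a b \<Rightarrow> if le A x a then In 2 u else In 1 u"])
     (auto split: if_splits)

text \<open>Turns a word over \<open>\<Gamma>\<^sub>p\<^sub>+\<^sub>1\<close> that avoids \<open>a\<close> into a word over \<open>\<Gamma>\<^sub>p\<close>, also for \<open>a = a\<^sub>p\<^sub>+\<^sub>1\<close>.\<close>

definition rename :: "elem \<Rightarrow> nat \<Rightarrow> elem list \<Rightarrow> elem list" where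
  "rename a p = map (\<lambda>b. if b = Letter (Suc p) then a else b)"

text \<open>On words without \<open>a\<close> the renaming is undone by a letterwise map, and
  letterwise maps preserve \<open>subseq\<close>.\<close>

lemma subseq_renameD:
  assumes "subseq (rename a p us) (rename a p vs)" "a \<notin> set us" "a \<notin> set vs"
  shows "subseq us vs"
proof -
  let ?g = "\<lambda>b. if b = a then Letter (Suc p) else b"
  have "map ?g (rename a p ws) = ws" if "a \<notin> set ws" for ws
    using that by (induction ws) (auto simp: rename_def)
  with subseq_map[OF assms(1), of ?g] assms(2,3) show ?thesis
    by simp
qed

lemma length_rename [simp]: "length (rename a p us) = length us"
  by (simp add: rename_def)

lemma rename_in_lists:
  assumes "a \<in> Letter ` {1..Suc p}" "us \<in> lists (Letter ` {1..Suc p})" "a \<notin> set us"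
  shows "rename a p us \<in> lists (Letter ` {1..p})"
proof -
  have "(if b = Letter (Suc p) then a else b) \<in> Letter ` {1..p}" if "b \<in> set us" for b
  proof -
    from that assms(2,3) have "b \<in> Letter ` {1..Suc p}" "b \<noteq> a"
      by (auto simp only: in_lists_conv_set)
    with assms(1) show ?thesis
      by (auto simp: le_Suc_eq)
  qed
  then show ?thesis
    by (simp only: rename_def in_lists_conv_set set_map ball_simps) blast
qed

text \<open>A word \<open>y\<close> with a letter \<open>a\<close> is cut at its first \<open>a\<close>: if \<open>y = uav\<close> then \<open>y\<close> avoids \<open>aw\<close> iff
  \<open>v\<close> avoids \<open>w\<close>.\<close>

lemma residual_star_Cons:
  assumes a: "a \<in> Letter ` {1..Suc p}"
  shows "residual (star_nqo (gamma_nqo (Suc p))) (Word (a # w)) \<hookrightarrow>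
    sum_nqo (star_nqo (gamma_nqo p))
      (prod_nqo (star_nqo (gamma_nqo p)) (residual (star_nqo (gamma_nqo (Suc p))) (Word w)))"
    (is "?R \<hookrightarrow> ?S")
proof -
  define pre where "pre = takeWhile (\<lambda>b. b \<noteq> a)"
  define post where "post = (\<lambda>ys. tl (dropWhile (\<lambda>b. b \<noteq> a) ys))"
  \<comment> \<open>A word without \<open>a\<close> avoids \<open>a # w\<close> for any
    \<open>w\<close>, so only its alphabet shrinks. Otherwise the prefix misses \<open>a\<close> and
    is renamed, while the suffix keeps the full alphabet.\<close>
  define h where "h = (\<lambda>u. case u of Word ys \<Rightarrow> if a \<in> set ys
    then In 2 (Tup (Word (rename a p (pre ys))) (Word (post ys)))
    else In 1 (Word (rename a p ys)))"
  have split: "ys = pre ys @ a # post ys" if "a \<in> set ys" for ys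
  proof -
    have "dropWhile (\<lambda>b. b \<noteq> a) ys = a # post ys"
      using that by (induction ys) (auto simp: post_def)
    then show ?thesis
      unfolding pre_def by (metis takeWhile_dropWhile_id)
  qed
  have pre: "a \<notin> set (pre ys)" for ys
    unfolding pre_def by (induction ys) auto
  have post: "\<not> subseq w (post ys)" if "a \<in> set ys" "\<not> subseq (a # w) ys" for ys
  proof
    assume "subseq w (post ys)"
    then have "subseq ([] @ a # w) (pre ys @ a # post ys)"
      by (intro list_emb_append_mono) auto
    with that split show False
      by simp
  qed
  show ?thesis
  proof (rule reflectsI[of _ h])
    fix x y
    assume "x \<in> carrier ?R"
    then obtain xs where xs: "x = Word xs" "xs \<in> lists (Letter ` {1..Suc p})"
      "\<not> subseq (a # w) xs"
      by (auto simp: in_lists_conv_set)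
    have len: "length (pre xs) < length xs" "length (post xs) < length xs" if "a \<in> set xs"
      using arg_cong[OF split[OF that], of length] by simp_all
    then show "nrm ?S (h x) \<le> nrm ?R x"
      by (auto simp: h_def xs(1))
    show "h x \<in> carrier ?S"
    proof (cases "a \<in> set xs")
      case True
      from split[OF True] xs(2)
      have "pre xs \<in> lists (Letter ` {1..Suc p})" "post xs \<in> lists (Letter ` {1..Suc p})"
        by (metis append_in_lists_conv, metis Cons_in_lists_iff append_in_lists_conv)
      with True show ?thesis
        using post[OF True xs(3)] rename_in_lists[OF a _ pre] by (auto simp: h_def xs(1))
    next
      case False
      then show ?thesis
        using rename_in_lists[OF a xs(2)] by (auto simp: h_def xs(1))
    qed
    assume "y \<in> carrier ?R" and le: "le ?S (h x) (h y)"
    then obtain ys where ys: "y = Word ys"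
      by auto
    \<comment> \<open>The summands are incomparable, so both words contain \<open>a\<close> or
      neither does; in the former case prefixes and suffixes embed separately and are glued around
      \<open>a\<close>.\<close>
    have "subseq xs ys"
    proof (cases "a \<in> set xs")
      case True
      with le have "a \<in> set ys" "subseq (rename a p (pre xs)) (rename a p (pre ys))"
        "subseq (post xs) (post ys)"
        by (auto simp: h_def xs(1) ys split: if_splits)
      with True have "subseq (pre xs @ a # post xs) (pre ys @ a # post ys)"
        by (intro list_emb_append_mono) (auto intro: subseq_renameD[OF _ pre pre])
      with split True \<open>a \<in> set ys\<close> show ?thesis
        by simp
    next
      case False
      with le show ?thesis
        by (auto simp: h_def xs(1) ys split: if_splits intro: subseq_renameD)
    qed
    then show "le ?R x y"
      by (simp add: xs(1) ys)
  qed
qed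

section \<open>The semiring of exponential nwqos up to mutual reflection\<close>

definition mutual :: "enwqo \<Rightarrow> enwqo \<Rightarrow> bool" where
  "mutual A B \<longleftrightarrow> nqo_of A \<hookrightarrow> nqo_of B \<and> nqo_of B \<hookrightarrow> nqo_of A"

quotient_type rclass = enwqo / mutual
  by (rule equivpI) (auto simp: mutual_def reflp_def symp_def transp_def
    intro: reflects_refl reflects_trans)

instantiation rclass :: "{comm_semiring_1, ordered_comm_semiring}"
begin

lift_definition zero_rclass :: rclass is "Gamma 0" .

lift_definition one_rclass :: rclass is "Gamma 1" .

lift_definition plus_rclass :: "rclass \<Rightarrow> rclass \<Rightarrow> rclass" is Plus
  by (auto simp: mutual_def intro: sum_mono)

lift_definition times_rclass :: "rclass \<Rightarrow> rclass \<Rightarrow> rclass" is Times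
  by (auto simp: mutual_def intro: prod_mono)

lift_definition less_eq_rclass :: "rclass \<Rightarrow> rclass \<Rightarrow> bool" is "\<lambda>A B. nqo_of A \<hookrightarrow> nqo_of B"
  unfolding mutual_def by (meson reflects_trans)

definition less_rclass :: "rclass \<Rightarrow> rclass \<Rightarrow> bool" where
  "less_rclass a b \<longleftrightarrow> a \<le> b \<and> \<not> b \<le> a"

instance
proof
  fix a b c :: rclass
  show le: "a \<le> a" "a \<le> b \<Longrightarrow> b \<le> c \<Longrightarrow> a \<le> c" "a \<le> b \<Longrightarrow> b \<le> a \<Longrightarrow> a = b"
    by (transfer, auto simp: mutual_def intro: reflects_refl reflects_trans)+
  show "a < b \<longleftrightarrow> a \<le> b \<and> \<not> b \<le> a"
    by (rule less_rclass_def)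
  show "a + b = b + a" "a * b = b * a"
    by (transfer, simp add: mutual_def sum_commute prod_commute)+
  show "0 + a = a"
    by transfer (simp add: mutual_def reflects_sum sum_empty)
  show "1 * a = a"
    by transfer (use prod_unit prod_unit_conv in \<open>simp add: mutual_def\<close>)
  show "(a + b) * c = a * c + b * c"
    by transfer (simp add: mutual_def prod_sum_distrib prod_sum_distrib_conv)
  show zero: "0 * a = 0"
    by transfer (simp add: mutual_def reflects_empty)
  show "a * 0 = 0"
    by transfer (simp add: mutual_def reflects_empty)
  show "(0::rclass) \<noteq> 1"
    by transfer (auto simp: mutual_def reflects_def is_reflection_def)
  show "c + a \<le> c + b" if "a \<le> b"
    using that by transfer (simp add: sum_mono reflects_refl)
  show "c * a \<le> c * b" if "a \<le> b"
    using that by transfer (simp add: prod_mono reflects_refl)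
  have assoc: "nqo_of (Plus (Plus A B) C) \<hookrightarrow> nqo_of (Plus A (Plus B C))"
    "nqo_of (Times (Times A B) C) \<hookrightarrow> nqo_of (Times A (Times B C))" for A B C
    by (simp_all add: sum_assoc prod_assoc)
  have comm: "nqo_of (Plus A B) \<hookrightarrow> nqo_of (Plus B A)"
    "nqo_of (Times A B) \<hookrightarrow> nqo_of (Times B A)" for A B
    by (simp_all add: sum_commute prod_commute)
  \<comment> \<open>\<open>comm\<close> followed by \<open>assoc\<close> rotates A + (B + C) into B
    + (C + A); two rotations and a last \<open>comm\<close> give (A + B) + C. Products go the same
    way.\<close>
  have assoc': "nqo_of (Plus A (Plus B C)) \<hookrightarrow> nqo_of (Plus (Plus A B) C)"
    "nqo_of (Times A (Times B C)) \<hookrightarrow> nqo_of (Times (Times A B) C)" for A B C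
    using reflects_trans[OF reflects_trans[OF comm(1)[of A "Plus B C"] assoc(1)]
       reflects_trans[OF comm(1) reflects_trans[OF assoc(1) comm(1)]]]
     reflects_trans[OF reflects_trans[OF comm(2)[of A "Times B C"] assoc(2)]
       reflects_trans[OF comm(2) reflects_trans[OF assoc(2) comm(2)]]] .
  show "a + b + c = a + (b + c)" "a * b * c = a * (b * c)"
    using assoc assoc' by (transfer, simp only: mutual_def)+
qed

end

lemma zero_le_rclass: "(0 :: rclass) \<le> a"
  by transfer (simp add: reflects_empty)

abbreviation rclass_of :: "enwqo \<Rightarrow> rclass" where
  "rclass_of \<equiv> abs_rclass"

lemma rclass_of_le_iff: "rclass_of A \<le> rclass_of B \<longleftrightarrow> nqo_of A \<hookrightarrow> nqo_of B"
  by (rule less_eq_rclass.abs_eq)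

lemma rclass_of_Plus [simp]: "rclass_of (Plus A B) = rclass_of A + rclass_of B"
  by (rule plus_rclass.abs_eq[symmetric])

lemma rclass_of_Times [simp]: "rclass_of (Times A B) = rclass_of A * rclass_of B"
  by (rule times_rclass.abs_eq[symmetric])

lemma rclass_of_Gamma [simp]: "rclass_of (Gamma p) = of_nat p"
proof (induction p)
  case 0
  show ?case by (simp add: zero_rclass.abs_eq)
next
  case (Suc p)
  have "rclass_of (Gamma (Suc p)) = rclass_of (Plus (Gamma 1) (Gamma p))"
    by (intro antisym) (auto simp: rclass_of_le_iff gamma_Suc gamma_Suc_conv simp flip: One_nat_def
      simp del: rclass_of_Plus)
  with Suc show ?case
    by (simp add: one_rclass.abs_eq del: One_nat_def)
qed

lemma rclass_of_Gamma_star_0 [simp]: "rclass_of (Gamma_star 0) = 1"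
  unfolding one_rclass.abs_eq
  by (intro antisym)
     (use star_gamma_0 gamma_1_star in \<open>simp_all add: rclass_of_le_iff del: rclass_of_Gamma\<close>)

lemma one_le_rclass_of_Gamma_star: "1 \<le> rclass_of (Gamma_star p)"
  unfolding one_rclass.abs_eq using gamma_1_star by (simp add: rclass_of_le_iff del: rclass_of_Gamma)

lemma rclass_of_big_plus: "rclass_of (big_plus As) = sum_list (map rclass_of As)"
  by (induction As rule: big_plus.induct) auto

lemma rclass_of_big_times: "rclass_of (big_times As) = prod_list (map rclass_of As)"
  by (induction As rule: big_times.induct) auto

section \<open>The homomorphism from ordinals to classes\<close>

definition term_class :: "nat multiset \<Rightarrow> rclass" where
  "term_class \<beta> = (\<Prod>p\<in>#\<beta>. rclass_of (Gamma_star (Suc p)))"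

text \<open>The class of C(\<alpha>), read off the multisets directly: classes commute, so the
  sorting in \<open>canon\<close> does not affect it.\<close>

definition ordinal_class :: "ordinal \<Rightarrow> rclass" where
  "ordinal_class \<alpha> = (\<Sum>\<beta>\<in>#exponents \<alpha>. term_class \<beta>)"

lemma term_class_add: "term_class (\<beta> + \<gamma>) = term_class \<beta> * term_class \<gamma>"
  by (simp add: term_class_def)

lemma rclass_of_canon_term: "rclass_of (canon_term \<beta>) = term_class \<beta>"
  by (simp add: canon_term_def rclass_of_big_times term_class_def o_def
    flip: prod_mset_prod_list rev_map)

lemma rclass_of_canon: "rclass_of (canon \<alpha>) = ordinal_class \<alpha>"
  by (simp add: canon_def rclass_of_big_plus ordinal_class_def o_def rclass_of_canon_term
    flip: sum_mset_sum_list rev_map)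

lemma ordinal_class_0 [simp]: "ordinal_class 0 = 0"
  by (simp add: ordinal_class_def zero_ordinal_def)

lemma ordinal_class_1 [simp]: "ordinal_class 1 = 1"
  by (simp add: ordinal_class_def one_ordinal_def term_class_def)

lemma ordinal_class_add [simp]: "ordinal_class (\<alpha> + \<beta>) = ordinal_class \<alpha> + ordinal_class \<beta>"
  by (simp add: ordinal_class_def plus_ordinal_def)

text \<open>The natural product adds exponents pairwise; \<open>term_class\<close> turns these sums
  into products, and distributivity does the rest.\<close>

lemma ordinal_class_mult [simp]: "ordinal_class (\<alpha> * \<beta>) = ordinal_class \<alpha> * ordinal_class \<beta>"
proof -
  have "(\<Sum>\<gamma>\<in>#(\<Sum>a\<in>#M. {#a + b. b \<in># N#}). term_class \<gamma>) =
      (\<Sum>a\<in>#M. term_class a) * (\<Sum>b\<in>#N. term_class b)" for M N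
    by (induction M)
       (auto simp: multiset.map_comp o_def term_class_add sum_mset_distrib_left distrib_right sum_mset.distrib)
  then show ?thesis
    by (simp add: ordinal_class_def times_ordinal_def)
qed

lemma ordinal_class_of_nat [simp]: "ordinal_class (of_nat k) = of_nat k"
  by (induction k) simp_all

lemma ordinal_class_omega_pow [simp]: "ordinal_class (omega_pow \<beta>) = term_class \<beta>"
  by (simp add: ordinal_class_def omega_pow_def)

text \<open>With \<open>rclass_of_canon\<close> this makes A and C(o(A)) reflect into each other. By
  the homomorphism laws only the values at the Gammas and their stars have to be compared.\<close>

lemma ordinal_class_otype: "ordinal_class (otype A) = rclass_of A"
  by (induction A rule: otype.induct) (simp_all add: term_class_def)

section \<open>Bounds on residuals\<close>

text \<open>A residual is an \<open>elem nqo\<close>, not an expression, so it has no class of its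
  own; an expression that it reflects into witnesses the bound.\<close>

definition bounded_by :: "elem nqo \<Rightarrow> rclass \<Rightarrow> bool" where
  "bounded_by N c \<longleftrightarrow> (\<exists>F. N \<hookrightarrow> nqo_of F \<and> rclass_of F \<le> c)"

lemma bounded_by_self: "bounded_by (nqo_of A) (rclass_of A)"
  unfolding bounded_by_def using reflects_refl by blast

lemma bounded_by_reflects: "M \<hookrightarrow> N \<Longrightarrow> bounded_by N c \<Longrightarrow> bounded_by M c"
  unfolding bounded_by_def using reflects_trans by blast

lemma bounded_by_mono: "bounded_by N c \<Longrightarrow> c \<le> d \<Longrightarrow> bounded_by N d"
  unfolding bounded_by_def using order_trans by blast

lemma bounded_by_empty: "carrier N = {} \<Longrightarrow> bounded_by N c"
  unfolding bounded_by_def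
  by (rule exI[of _ "Gamma 0"]) (simp add: reflects_empty zero_le_rclass)

lemma bounded_by_sum:
  assumes "bounded_by M c" "bounded_by N d"
  shows "bounded_by (sum_nqo M N) (c + d)"
proof -
  obtain F G where "M \<hookrightarrow> nqo_of F" "rclass_of F \<le> c" "N \<hookrightarrow> nqo_of G" "rclass_of G \<le> d"
    using assms by (auto simp: bounded_by_def)
  then show ?thesis
    unfolding bounded_by_def by (intro exI[of _ "Plus F G"]) (simp add: sum_mono add_mono)
qed

lemma bounded_by_prod:
  assumes "bounded_by M c" "bounded_by N d"
  shows "bounded_by (prod_nqo M N) (c * d)"
proof -
  obtain F G where "M \<hookrightarrow> nqo_of F" "rclass_of F \<le> c" "N \<hookrightarrow> nqo_of G" "rclass_of G \<le> d"
    using assms by (auto simp: bounded_by_def)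
  then show ?thesis
    unfolding bounded_by_def
    by (intro exI[of _ "Times F G"]) (simp add: prod_mono mult_mono' zero_le_rclass)
qed

text \<open>Quantifying over all expressions of class \<open>c\<close> lets \<open>c\<close> be
  rewritten by semiring laws. The bound from \<open>S\<close> may depend on \<open>x\<close>: in a
  sum it depends on the summand containing \<open>x\<close>.\<close>

definition residual_bounds :: "nat \<Rightarrow> rclass \<Rightarrow> rclass set \<Rightarrow> bool" where
  "residual_bounds n c S \<longleftrightarrow> (\<forall>A x. rclass_of A = c \<longrightarrow> x \<in> carrier (nqo_of A) \<longrightarrow>
    nrm (nqo_of A) x < n \<longrightarrow> (\<exists>s\<in>S. bounded_by (residual (nqo_of A) x) s))"

text \<open>One representative suffices: a reflection from any other into it carries
  \<open>x\<close> over without raising the norm, and carries the residual along.\<close>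

lemma residual_boundsI:
  assumes "\<And>x. x \<in> carrier (nqo_of A) \<Longrightarrow> nrm (nqo_of A) x < n \<Longrightarrow>
    \<exists>s\<in>S. bounded_by (residual (nqo_of A) x) s"
  shows "residual_bounds n (rclass_of A) S"
  unfolding residual_bounds_def
proof (intro allI impI)
  fix B x
  assume "rclass_of B = rclass_of A" and x: "x \<in> carrier (nqo_of B)" "nrm (nqo_of B) x < n"
  then have "nqo_of B \<hookrightarrow> nqo_of A"
    by (simp flip: rclass_of_le_iff)
  from reflects_residual[OF this x(1)] obtain y where "y \<in> carrier (nqo_of A)"
    "nrm (nqo_of A) y \<le> nrm (nqo_of B) x" "residual (nqo_of B) x \<hookrightarrow> residual (nqo_of A) y" .
  with assms x(2) show "\<exists>s\<in>S. bounded_by (residual (nqo_of B) x) s"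
    by (meson bounded_by_reflects le_less_trans)
qed

lemma residual_bounds_add:
  assumes "residual_bounds n c S" "residual_bounds n d T"
  shows "residual_bounds n (c + d) ((\<lambda>s. s + d) ` S \<union> (\<lambda>t. c + t) ` T)"
proof -
  obtain A B where AB: "c = rclass_of A" "d = rclass_of B"
    by (metis Quotient3_abs_rep Quotient3_rclass)
  have "residual_bounds n (rclass_of (Plus A B)) ((\<lambda>s. s + d) ` S \<union> (\<lambda>t. c + t) ` T)"
  proof (rule residual_boundsI)
    fix x
    assume "x \<in> carrier (nqo_of (Plus A B))" and n: "nrm (nqo_of (Plus A B)) x < n"
    then consider (left) y where "x = In 1 y" "y \<in> carrier (nqo_of A)"
      | (right) y where "x = In 2 y" "y \<in> carrier (nqo_of B)"
      by auto
    then show "\<exists>s\<in>(\<lambda>s. s + d) ` S \<union> (\<lambda>t. c + t) ` T.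
      bounded_by (residual (nqo_of (Plus A B)) x) s"
    proof cases
      case left
      with assms(1) n AB obtain s where "s \<in> S" "bounded_by (residual (nqo_of A) y) s"
        by (auto simp: residual_bounds_def)
      then have "bounded_by (residual (nqo_of (Plus A B)) x) (s + d)"
        using residual_sum_left left(1) bounded_by_sum bounded_by_self
        unfolding AB(2) nqo_of.simps by (metis bounded_by_reflects)
      with \<open>s \<in> S\<close> show ?thesis by blast
    next
      case right
      with assms(2) n AB obtain t where "t \<in> T" "bounded_by (residual (nqo_of B) y) t"
        by (auto simp: residual_bounds_def)
      then have "bounded_by (residual (nqo_of (Plus A B)) x) (c + t)"
        using residual_sum_right right(1) bounded_by_sum bounded_by_self
        unfolding AB(1) nqo_of.simps by (metis bounded_by_reflects)
      with \<open>t \<in> T\<close> show ?thesis by blast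
    qed
  qed
  then show ?thesis
    by (simp add: AB)
qed

text \<open>The Leibniz rule behind \<open>deriv_term\<close>, from \<open>residual_prod\<close>.
  Singletons express that one bound serves all elements of norm below \<open>n\<close>.\<close>

lemma residual_bounds_mult:
  assumes "residual_bounds n c {s}" "residual_bounds n d {t}"
  shows "residual_bounds n (c * d) {s * d + c * t}"
proof -
  obtain A B where AB: "c = rclass_of A" "d = rclass_of B"
    by (metis Quotient3_abs_rep Quotient3_rclass)
  have "residual_bounds n (rclass_of (Times A B)) {s * d + c * t}"
  proof (rule residual_boundsI)
    fix x
    assume "x \<in> carrier (nqo_of (Times A B))" and n: "nrm (nqo_of (Times A B)) x < n"
    then obtain y z where x: "x = Tup y z" "y \<in> carrier (nqo_of A)" "z \<in> carrier (nqo_of B)"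
      by auto
    with assms n AB have "bounded_by (residual (nqo_of A) y) s" "bounded_by (residual (nqo_of B) z) t"
      by (auto simp: residual_bounds_def)
    then have "bounded_by (sum_nqo (prod_nqo (residual (nqo_of A) y) (nqo_of B))
        (prod_nqo (nqo_of A) (residual (nqo_of B) z))) (s * d + c * t)"
      unfolding AB by (intro bounded_by_sum bounded_by_prod bounded_by_self)
    then show "\<exists>r\<in>{s * d + c * t}. bounded_by (residual (nqo_of (Times A B)) x) r"
      using residual_prod bounded_by_reflects by (simp add: x) blast
  qed
  then show ?thesis
    by (simp add: AB)
qed

text \<open>By \<open>residual_star_Cons\<close>, prefixing a letter turns a bound b into g + g * b,
  where g is the class of the star over \<open>p\<close> letters. The exponent \<open>k\<close> may
  exceed the length, so that all short words can later share the exponent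
  \<open>n - 1\<close>.\<close>

lemma bounded_by_residual_star:
  assumes "w \<in> lists (Letter ` {1..Suc p})" "length w \<le> k"
  shows "bounded_by (residual (nqo_of (Gamma_star (Suc p))) (Word w))
    (of_nat (length w) * rclass_of (Gamma_star p) ^ k)"
  using assms
proof (induction w arbitrary: k)
  \<comment> \<open>Every word lies above the empty word, so this residual is empty.\<close>
  case Nil
  then show ?case
    by (intro bounded_by_empty) auto
next
  case (Cons a w)
  define g where "g = rclass_of (Gamma_star p)"
  from Cons.prems obtain l where k: "k = Suc l" "length w \<le> l"
    by (cases k) auto
  have g: "1 \<le> g ^ i" for i
  proof (induction i)
    case (Suc i)
    have "1 * 1 \<le> g * g ^ i"
      using Suc one_le_rclass_of_Gamma_star by (intro mult_mono') (auto simp: g_def zero_le_rclass)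
    then show ?case by simp
  qed simp
  have "bounded_by (residual (nqo_of (Gamma_star (Suc p))) (Word (a # w)))
      (g + g * (of_nat (length w) * g ^ l))"
    using Cons residual_star_Cons[of a p w] k unfolding g_def
    by (intro bounded_by_reflects[OF _ bounded_by_sum[OF bounded_by_self
        bounded_by_prod[OF bounded_by_self]]]) auto
  \<comment> \<open>Since 1 \<le> \<open>g ^ l\<close>, the extra summand \<open>g\<close> is at
    most \<open>g * g ^ l\<close>, which is \<open>g ^ k\<close>.\<close>
  moreover have "g + g * (of_nat (length w) * g ^ l) \<le> of_nat (length (a # w)) * g ^ k"
    using mult_left_mono[OF g[of l] zero_le_rclass[of g]]
    by (simp add: k algebra_simps add_right_mono)
  ultimately show ?case
    unfolding g_def by (rule bounded_by_mono)
qed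

lemma of_nat_rclass_mono: "m \<le> k \<Longrightarrow> (of_nat m :: rclass) \<le> of_nat k"
  using add_left_mono[OF zero_le_rclass[of "of_nat (k - m)"], of "of_nat m"]
  by (simp flip: of_nat_add)

lemma term_class_replicate: "term_class (replicate_mset k p) = rclass_of (Gamma_star (Suc p)) ^ k"
  by (simp add: term_class_def)

lemma residual_bounds_atom:
  "residual_bounds n (term_class {#p#}) {ordinal_class (deriv_atom n p)}"
proof -
  define g where "g = rclass_of (Gamma_star p)"
  \<comment> \<open>For \<open>p = 0\<close> the star over no letters has class 1, so both cases of
    \<open>deriv_atom\<close> take this one form.\<close>
  have D: "ordinal_class (deriv_atom n p) = of_nat (n - 1) * g ^ (n - 1)"
    by (cases p) (auto simp: deriv_atom_def term_class_replicate g_def mult.commute)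
  have "residual_bounds n (rclass_of (Gamma_star (Suc p))) {of_nat (n - 1) * g ^ (n - 1)}"
  proof (rule residual_boundsI)
    fix x
    assume "x \<in> carrier (nqo_of (Gamma_star (Suc p)))"
      "nrm (nqo_of (Gamma_star (Suc p))) x < n"
    \<comment> \<open>Letters have norm 0, so norm below \<open>n\<close> means at most
      \<open>n - 1\<close> letters.\<close>
    then obtain w where w: "x = Word w" "w \<in> lists (Letter ` {1..Suc p})" "length w \<le> n - 1"
      by (auto simp: in_lists_conv_set)
    then have "(of_nat (length w) :: rclass) * g ^ (n - 1) \<le> of_nat (n - 1) * g ^ (n - 1)"
      by (intro mult_right_mono of_nat_rclass_mono zero_le_rclass)
    with bounded_by_residual_star[OF w(2,3)]
    show "\<exists>s\<in>{of_nat (n - 1) * g ^ (n - 1)}.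
        bounded_by (residual (nqo_of (Gamma_star (Suc p))) x) s"
      unfolding w(1) g_def by (blast intro: bounded_by_mono)
  qed
  then show ?thesis
    by (simp add: D term_class_def)
qed

section \<open>Recursions for derivatives of Cantor normal forms\<close>

lemma prod_omega_pow: "(\<Prod>q\<in>#\<beta>. omega_pow {#q#}) = omega_pow \<beta>"
  by (induction \<beta>)
     (simp_all add: omega_pow_def one_ordinal_def times_ordinal_def)

lemma deriv_term_empty: "deriv_term n {#} = 0"
  by (simp add: deriv_term_def)

text \<open>Splitting off one factor gives the recursion that \<open>residual_bounds_mult\<close>
  follows.\<close>

lemma deriv_term_add_mset:
  "deriv_term n (add_mset p \<beta>) =
    deriv_atom n p * omega_pow \<beta> + omega_pow {#p#} * deriv_term n \<beta>"
proof -
  have "(\<Sum>q\<in>#\<beta>. deriv_atom n q * (\<Prod>r\<in>#add_mset p \<beta> - {#q#}. omega_pow {#r#})) =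
      (\<Sum>q\<in>#\<beta>. omega_pow {#p#} * (deriv_atom n q * (\<Prod>r\<in>#\<beta> - {#q#}. omega_pow {#r#})))"
  proof (intro arg_cong[where f = sum_mset] image_mset_cong)
    fix q
    assume "q \<in># \<beta>"
    \<comment> \<open>As \<open>q\<close> occurs in \<open>\<beta>\<close>, the removed copy can be
      taken from there, even if \<open>q = p\<close>.\<close>
    then have "add_mset p \<beta> - {#q#} = add_mset p (\<beta> - {#q#})"
      by simp
    then show "deriv_atom n q * (\<Prod>r\<in>#add_mset p \<beta> - {#q#}. omega_pow {#r#}) =
        omega_pow {#p#} * (deriv_atom n q * (\<Prod>r\<in>#\<beta> - {#q#}. omega_pow {#r#}))"
      by (simp only:) (simp add: ac_simps)
  qed
  then show ?thesis
    by (simp add: deriv_term_def prod_omega_pow sum_mset_distrib_left)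
qed

lemma residual_bounds_term:
  "residual_bounds n (term_class \<beta>) {ordinal_class (deriv_term n \<beta>)}"
proof (induction \<beta>)
  case empty
  \<comment> \<open>The only letter lies below itself, so its residual is empty, in accordance with
    D_n(1) = 0.\<close>
  have "residual_bounds n (rclass_of (Gamma 1)) {0}"
    by (rule residual_boundsI) (auto intro: bounded_by_empty)
  then show ?case
    by (simp add: term_class_def deriv_term_empty)
next
  case (add p \<beta>)
  with residual_bounds_mult[OF residual_bounds_atom add] show ?case
    by (simp add: deriv_term_add_mset flip: term_class_add)
qed

lemma sum_omega_pow: "(\<Sum>\<beta>\<in>#M. omega_pow \<beta>) = CNF M"
  by (induction M) (simp_all add: omega_pow_def zero_ordinal_def plus_ordinal_def)

lemma CNF_add_mset: "CNF (add_mset \<beta> M) = omega_pow \<beta> + CNF M"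
  by (simp add: omega_pow_def plus_ordinal_def)

lemma derivs_CNF: "derivs n (CNF M) = (\<lambda>\<beta>. deriv_term n \<beta> + CNF (M - {#\<beta>#})) ` set_mset M"
  by (auto simp: derivs_def sum_omega_pow)

text \<open>Either the new summand is differentiated, or it is kept while an old one is: the two
  cases of \<open>residual_bounds_add\<close>.\<close>

lemma derivs_omega_pow_add:
  "derivs n (omega_pow \<beta> + CNF M) =
    insert (deriv_term n \<beta> + CNF M) ((\<lambda>\<alpha>. omega_pow \<beta> + \<alpha>) ` derivs n (CNF M))"
proof -
  have "deriv_term n \<gamma> + CNF (add_mset \<beta> M - {#\<gamma>#}) =
      omega_pow \<beta> + (deriv_term n \<gamma> + CNF (M - {#\<gamma>#}))" if "\<gamma> \<in># M" for \<gamma>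
  proof -
    have "add_mset \<beta> M - {#\<gamma>#} = add_mset \<beta> (M - {#\<gamma>#})"
      using that by simp
    then show ?thesis
      by (simp only: CNF_add_mset) (simp add: ac_simps)
  qed
  then show ?thesis
    by (simp add: derivs_CNF image_image flip: CNF_add_mset cong: image_cong)
qed

lemma residual_bounds_ordinal:
  "residual_bounds n (ordinal_class (CNF M)) (ordinal_class ` derivs n (CNF M))"
proof (induction M)
  case empty
  have "residual_bounds n (rclass_of (Gamma 0)) {}"
    by (rule residual_boundsI) auto
  moreover have "derivs n (CNF {#}) = {}" "ordinal_class (CNF {#}) = 0"
    by (simp_all add: derivs_CNF ordinal_class_def)
  ultimately show ?case
    by simp
next
  case (add \<beta> M)
  from residual_bounds_add[OF residual_bounds_term add] show ?case
    by (simp add: derivs_omega_pow_add CNF_add_mset image_image)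
qed

theorem mainTheorem3:
  fixes A :: enwqo and n :: nat and x :: elem
  assumes "x \<in> carrier (nqo_of A)"
    and "nrm (nqo_of A) x < n"
  shows "\<exists>\<alpha>' \<in> derivs n (otype A). residual (nqo_of A) x \<hookrightarrow> nqo_of (canon \<alpha>')"
proof -
  \<comment> \<open>\<open>A\<close> has the class of C(o(A)), so the bounds found for Cantor normal
    forms apply to \<open>A\<close> itself.\<close>
  have "residual_bounds n (rclass_of A) (ordinal_class ` derivs n (otype A))"
    using residual_bounds_ordinal[of n "exponents (otype A)"] by (simp add: ordinal_class_otype)
  with assms obtain \<alpha> where "\<alpha> \<in> derivs n (otype A)"
    "bounded_by (residual (nqo_of A) x) (rclass_of (canon \<alpha>))"
    by (auto simp: residual_bounds_def rclass_of_canon)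
  then show ?thesis
    unfolding bounded_by_def rclass_of_le_iff by (meson reflects_trans)
qed

end
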